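(* Let $\Omega$ be a nonempty set, $Y$ a real Banach space, $\mathcal X$ a Banach subspace of $\mathcal B(\Omega,Y)$, and let $M$ be a nonempty bounded subset of $\mathcal X$. Then $$\max\left\{\mu_\gamma(M),\ \tfrac12\,\omega_{\mathcal X}(M)\right\}\le\gamma_{\mathcal X}(M)\le 2\left(\mu_\gamma(M)+\omega_{\mathcal X}(M)\right).$$
   Context: $\mathcal B(\Omega,Y)$ is the Banach space of all bounded functions $f:\Omega\to Y$ with norm $\|f\|_\infty=\sup_{x\in\Omega}\|f(x)\|$. A Banach subspace of $\mathcal B(\Omega,Y)$ is a closed linear subspace equipped with $\|\cdot\|_\infty$ (possibly the whole space). For a nonempty bounded subset $M$ of a Banach space $E$, the Hausdorff measure of noncompactness $\gamma_E(M)$ is the infimum of all $\varepsilon>0$ such that $M$ has a finite $\varepsilon$-net in $E$, i.e. there is a finite set $F\subseteq E$ (not necessarily contained in $M$) such that every point of $M$ is at distance at most $\varepsilon$ from some point of $F$; $\gamma=\gamma_Y$. For $x\in\Omega$, $M(x)=\{f(x):f\in M\}\subseteq Y$, and $\mu_\gamma(M)=\sup_{x\in\Omega}\gamma(M(x))$. For a bounded $M\subseteq \mathcal X$, $\omega_{\mathcal X}(M)$ is the infimum of all $\varepsilon>0$ for which there are a finite partition $\{A_1,\dots,A_n\}$ of $\Omega$ and a finite set $\{\varphi_1,\dots,\varphi_m\}\subseteq\mathcal X$ such that for every $f\in M$ there is $j\in\{1,\dots,m\}$ with $\operatorname{diam}((f-\varphi_j)(A_i))\le\varepsilon$ for all $i=1,\dots,n$.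 *)

theory Defs
  imports "HOL-Analysis.Analysis" "HOL-Library.Disjoint_Sets"
begin

text \<open>
  The space of bounded functions from a set \<open>\<Omega>\<close> to \<open>Y\<close> is the library's \<^const>\<open>funspace\<close>: its points
  are the bounded functions on \<open>\<Omega>\<close>, made total by the value \<^const>\<open>undefined\<close> outside \<open>\<Omega>\<close>
  (\<^const>\<open>extensional\<close>), and its distance is the supremum distance over \<open>\<Omega>\<close>.
\<close>

definition bfuns :: "'a set \<Rightarrow> ('a \<Rightarrow> 'y::real_normed_vector) metric" where
  "bfuns \<Omega> = funspace \<Omega> euclidean_metric"

lemma mspace_bfuns: "mspace (bfuns \<Omega>) = {f \<in> extensional \<Omega>. bounded (f ` \<Omega>)}"
  by (auto simp: bfuns_def Metric_space.fspace_def Met_TC.fspace_def)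

lemma mdist_bfuns:
  assumes "\<Omega> \<noteq> {}" "f \<in> mspace (bfuns \<Omega>)" "g \<in> mspace (bfuns \<Omega>)"
  shows "mdist (bfuns \<Omega>) f g = (SUP x\<in>\<Omega>. norm (f x - g x))"
  using assms by (auto simp: bfuns_def Met_TC.fdist_def dist_norm)

text \<open>The linear operations are pointwise on \<open>\<Omega>\<close>, restricted so as to stay in \<^const>\<open>extensional\<close>.\<close>

definition banach_subspace :: "'a set \<Rightarrow> ('a \<Rightarrow> 'y::real_normed_vector) set \<Rightarrow> bool" where
  "banach_subspace \<Omega> X \<longleftrightarrow>
     X \<subseteq> mspace (bfuns \<Omega>) \<and>
     (\<lambda>x\<in>\<Omega>. 0) \<in> X \<and>
     (\<forall>f\<in>X. \<forall>g\<in>X. (\<lambda>x\<in>\<Omega>. f x + g x) \<in> X) \<and>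
     (\<forall>c::real. \<forall>f\<in>X. (\<lambda>x\<in>\<Omega>. c *\<^sub>R f x) \<in> X) \<and>
     closedin (mtopology_of (bfuns \<Omega>)) X"

text \<open>
  The ambient space \<open>E\<close>, in which the centres of the nets are taken, is the space of points of the
  given metric. As in \<open>mu_gamma\<close> and \<open>omega\<close> below, infima and suprema are taken in the reals and
  are meaningful for bounded sets only.
\<close>

definition hausdorff_mnc :: "'e metric \<Rightarrow> 'e set \<Rightarrow> real" where
  "hausdorff_mnc E M =
     Inf {\<epsilon>. \<epsilon> > 0 \<and>
       (\<exists>F. finite F \<and> F \<subseteq> mspace E \<and> (\<forall>x\<in>M. \<exists>y\<in>F. mdist E x y \<le> \<epsilon>))}"

definition mu_gamma :: "'a set \<Rightarrow> ('a \<Rightarrow> 'y::real_normed_vector) set \<Rightarrow> real" where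
  "mu_gamma \<Omega> M = (SUP x\<in>\<Omega>. hausdorff_mnc euclidean_metric ((\<lambda>f. f x) ` M))"

definition omega :: "'a set \<Rightarrow> ('a \<Rightarrow> 'y::real_normed_vector) set \<Rightarrow> ('a \<Rightarrow> 'y) set \<Rightarrow> real" where
  "omega \<Omega> X M =
     Inf {\<epsilon>. \<epsilon> > 0 \<and>
       (\<exists>P \<Phi>. finite P \<and> partition_on \<Omega> P \<and> finite \<Phi> \<and> \<Phi> \<subseteq> X \<and>
         (\<forall>f\<in>M. \<exists>\<phi>\<in>\<Phi>. \<forall>A\<in>P. diameter ((\<lambda>x. f x - \<phi> x) ` A) \<le> \<epsilon>))}"

end

theory Submission
  imports Defs
begin

text \<open>
  A finite net of \<open>M\<close> in \<open>X\<close> evaluates at each point to a net of \<open>M(x)\<close>, and together with the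
  trivial partition \<open>{\<Omega>}\<close> it witnesses an oscillation of at most twice its mesh. Conversely, given a
  partition with functions \<open>\<phi>\<^sub>j\<close> and nets of \<open>M(x)\<close> at one chosen point of each block, classify
  \<open>f \<in> M\<close> by its \<open>\<phi>\<^sub>j\<close> and by the net point nearest to \<open>f\<close> in each block. There are finitely many classes
  and each has small diameter, so one representative per class gives a net. The factor 2 in the
  upper bound is the price for taking the centres in \<open>M\<close>, since a function glued together from the
  \<open>\<phi>\<^sub>j\<close> and the net points need not lie in \<open>X\<close>.
\<close>

lemma hausdorff_mnc_le:
  assumes "\<epsilon> > 0" "finite F" "F \<subseteq> mspace E" "\<And>x. x \<in> M \<Longrightarrow> \<exists>y\<in>F. mdist E x y \<le> \<epsilon>"
  shows "hausdorff_mnc E M \<le> \<epsilon>"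
  unfolding hausdorff_mnc_def
  using assms by (intro cInf_lower bdd_belowI[of _ 0]) auto

text \<open>The net \<open>F\<close> of mesh \<open>c\<close> makes the set of admissible meshes
  nonempty, without which its real infimum would carry no information.\<close>

lemma hausdorff_mnc_greatest:
  assumes "c > 0" "F \<subseteq> mspace E" "finite F" "\<And>x. x \<in> M \<Longrightarrow> \<exists>y\<in>F. mdist E x y \<le> c"
    and "\<And>\<epsilon> F. \<lbrakk>\<epsilon> > 0; finite F; F \<subseteq> mspace E; \<And>x. x \<in> M \<Longrightarrow> \<exists>y\<in>F. mdist E x y \<le> \<epsilon>\<rbrakk> \<Longrightarrow> b \<le> \<epsilon>"
  shows "b \<le> hausdorff_mnc E M"
  unfolding hausdorff_mnc_def
proof (rule cInf_greatest)
  show "{\<epsilon>. \<epsilon> > 0 \<and> (\<exists>F. finite F \<and> F \<subseteq> mspace E \<and> (\<forall>x\<in>M. \<exists>y\<in>F. mdist E x y \<le> \<epsilon>))} \<noteq> {}"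
    using assms(1-4) by blast
qed (use assms(5) in blast)

text \<open>The infimum need not be attained, so a net is extracted only for a mesh strictly above
  it. The net \<open>F0\<close> again guarantees that some mesh is admissible.\<close>

lemma hausdorff_mnc_lessE:
  assumes "hausdorff_mnc E M < e"
    and "c > 0" "F0 \<subseteq> mspace E" "finite F0" "\<And>x. x \<in> M \<Longrightarrow> \<exists>y\<in>F0. mdist E x y \<le> c"
  obtains F where "finite F" "F \<subseteq> mspace E" "\<And>x. x \<in> M \<Longrightarrow> \<exists>y\<in>F. mdist E x y \<le> e"
proof -
  have "\<not> e \<le> hausdorff_mnc E M"
    using assms(1) by simp
  then obtain \<epsilon> F where "finite F" "F \<subseteq> mspace E" "\<And>x. x \<in> M \<Longrightarrow> \<exists>y\<in>F. mdist E x y \<le> \<epsilon>" "\<epsilon> < e"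
    using hausdorff_mnc_greatest[OF assms(2-5), where b = e] by (metis not_le)
  then show thesis
    by (meson that less_imp_le order_trans)
qed

lemma mdist_bfuns_le_iff:
  assumes "\<Omega> \<noteq> {}" "f \<in> mspace (bfuns \<Omega>)" "g \<in> mspace (bfuns \<Omega>)"
  shows "mdist (bfuns \<Omega>) f g \<le> r \<longleftrightarrow> (\<forall>x\<in>\<Omega>. norm (f x - g x) \<le> r)"
proof -
  have "bounded ((\<lambda>x. f x - g x) ` \<Omega>)"
    using assms(2,3) by (intro bounded_minus_comp) (auto simp: mspace_bfuns)
  then have "bdd_above ((\<lambda>x. norm (f x - g x)) ` \<Omega>)"
    by (auto simp: bounded_iff bdd_above_def)
  then show ?thesis
    using assms by (simp add: mdist_bfuns cSUP_le_iff)
qed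

lemma omega_le:
  assumes "\<epsilon> > 0" "finite P" "partition_on \<Omega> P" "finite \<Phi>" "\<Phi> \<subseteq> X"
    and "\<And>f. f \<in> M \<Longrightarrow> \<exists>\<phi>\<in>\<Phi>. \<forall>A\<in>P. diameter ((\<lambda>x. f x - \<phi> x) ` A) \<le> \<epsilon>"
  shows "omega \<Omega> X M \<le> \<epsilon>"
  unfolding omega_def
proof (rule cInf_lower)
  show "\<epsilon> \<in> {\<epsilon>. \<epsilon> > 0 \<and> (\<exists>P \<Phi>. finite P \<and> partition_on \<Omega> P \<and> finite \<Phi> \<and> \<Phi> \<subseteq> X \<and>
         (\<forall>f\<in>M. \<exists>\<phi>\<in>\<Phi>. \<forall>A\<in>P. diameter ((\<lambda>x. f x - \<phi> x) ` A) \<le> \<epsilon>))}"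
    using assms by blast
qed (auto intro: bdd_belowI[of _ 0])

text \<open>The differences lie in a ball of radius \<open>\<epsilon>\<close> about 0. The doubled
  radius is the source of the factor 1/2 in front of \<open>omega\<close> in the lower
  bound.\<close>

lemma diameter_diff_le:
  fixes f g :: "'a \<Rightarrow> 'y::real_normed_vector"
  assumes "A \<noteq> {}" "\<And>x. x \<in> A \<Longrightarrow> norm (f x - g x) \<le> \<epsilon>"
  shows "diameter ((\<lambda>x. f x - g x) ` A) \<le> 2 * \<epsilon>"
proof (rule diameter_le)
  fix u v assume "u \<in> (\<lambda>x. f x - g x) ` A" "v \<in> (\<lambda>x. f x - g x) ` A"
  then have "norm u \<le> \<epsilon>" "norm v \<le> \<epsilon>"
    using assms(2) by auto
  then show "norm (u - v) \<le> 2 * \<epsilon>"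
    using norm_triangle_ineq4[of u v] by linarith
qed (use assms(1) in simp)

lemma finite_class_representatives:
  assumes "finite (c ` M)"
  obtains F where "finite F" "F \<subseteq> M" "\<And>f. f \<in> M \<Longrightarrow> \<exists>g\<in>F. c g = c f"
proof
  show "finite (inv_into M c ` c ` M)"
    using assms by blast
  show "inv_into M c ` c ` M \<subseteq> M"
    by (auto intro: inv_into_into)
  show "\<exists>g\<in>inv_into M c ` c ` M. c g = c f" if "f \<in> M" for f
    using that by (auto simp: f_inv_into_f)
qed

text \<open>If \<open>f\<close> and \<open>g\<close> share their \<open>\<phi>\<close> and their net
  points, then from \<open>x\<close> to the chosen point of its block \<open>f - \<phi>\<close> and
  \<open>g - \<phi>\<close> each vary by at most \<open>\<delta>\<close>, and there \<open>f\<close>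
  and \<open>g\<close> are each within \<open>\<epsilon>\<close> of one net point. The four errors
  add up to the bound.\<close>

lemma finite_net_of_oscillation:
  fixes M \<Phi> :: "('a \<Rightarrow> 'y::real_normed_vector) set"
  assumes "finite P" "partition_on \<Omega> P" "finite \<Phi>"
    and bnd: "\<And>f. f \<in> M \<union> \<Phi> \<Longrightarrow> bounded (f ` \<Omega>)"
    and osc: "\<And>f. f \<in> M \<Longrightarrow> \<exists>\<phi>\<in>\<Phi>. \<forall>A\<in>P. diameter ((\<lambda>x. f x - \<phi> x) ` A) \<le> \<delta>"
    and net: "\<And>x. x \<in> \<Omega> \<Longrightarrow> \<exists>N. finite N \<and> (\<forall>f\<in>M. \<exists>y\<in>N. dist (f x) y \<le> \<epsilon>)"
  obtains F where "finite F" "F \<subseteq> M"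
    "\<And>f. f \<in> M \<Longrightarrow> \<exists>g\<in>F. \<forall>x\<in>\<Omega>. norm (f x - g x) \<le> 2 * (\<epsilon> + \<delta>)"
proof -
  define a where "a A = (SOME x. x \<in> A)" for A :: "'a set"
  have a: "a A \<in> A" if "A \<in> P" for A
    using that assms(2) some_in_eq[of A] by (auto simp: a_def partition_on_def)
  have sub: "A \<subseteq> \<Omega>" if "A \<in> P" for A
    using that assms(2) by (auto simp: partition_on_def)
  have "\<forall>A\<in>P. \<exists>N. finite N \<and> (\<forall>f\<in>M. \<exists>y\<in>N. dist (f (a A)) y \<le> \<epsilon>)"
    using a sub net by blast
  then obtain N where N: "\<And>A. A \<in> P \<Longrightarrow> finite (N A)"
    and "\<forall>A\<in>P. \<forall>f\<in>M. \<exists>y\<in>N A. dist (f (a A)) y \<le> \<epsilon>"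
    by metis
  then obtain k where k: "\<And>A f. \<lbrakk>A \<in> P; f \<in> M\<rbrakk> \<Longrightarrow> k A f \<in> N A \<and> dist (f (a A)) (k A f) \<le> \<epsilon>"
    by metis
  obtain p where p: "\<And>f. f \<in> M \<Longrightarrow> p f \<in> \<Phi>"
    and osc_p: "\<And>f A. \<lbrakk>f \<in> M; A \<in> P\<rbrakk> \<Longrightarrow> diameter ((\<lambda>x. f x - p f x) ` A) \<le> \<delta>"
    using osc by metis
  \<comment> \<open>Restricting the choice of net points to \<open>P\<close> places it in
    \<open>PiE P N\<close>, which is finite.\<close>
  define c where "c f = (p f, \<lambda>A\<in>P. k A f)" for f
  have "c ` M \<subseteq> \<Phi> \<times> PiE P N"
    using p k by (auto simp: c_def)
  then have "finite (c ` M)"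
    using assms(1,3) N by (meson finite_PiE finite_SigmaI finite_subset)
  then obtain F where F: "finite F" "F \<subseteq> M" "\<And>f. f \<in> M \<Longrightarrow> \<exists>g\<in>F. c g = c f"
    by (rule finite_class_representatives) blast
  have osc_le: "norm ((f x - p f x) - (f y - p f y)) \<le> \<delta>"
    if "f \<in> M" "A \<in> P" "x \<in> A" "y \<in> A" for f A x y
  proof -
    \<comment> \<open>\<open>diameter\<close> is a real supremum and dominates the distances only on
      a bounded set.\<close>
    have "bounded ((\<lambda>x. f x - p f x) ` A)"
      using that p sub[of A] bnd[of f] bnd[of "p f"]
      by (intro bounded_minus_comp) (auto intro: bounded_subset[OF _ image_mono])
    then have "dist (f x - p f x) (f y - p f y) \<le> diameter ((\<lambda>x. f x - p f x) ` A)"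
      using that by (intro diameter_bounded_bound) auto
    then show ?thesis
      using osc_p[of f A] that by (simp add: dist_norm)
  qed
  have close: "norm (f x - g x) \<le> 2 * (\<epsilon> + \<delta>)"
    if fg: "f \<in> M" "g \<in> M" "c g = c f" and x: "x \<in> \<Omega>" for f g x
  proof -
    obtain A where A: "A \<in> P" "x \<in> A"
      using x assms(2) by (auto simp: partition_on_def)
    let ?y = "a A"
    have pk: "p g = p f" "k A g = k A f"
      using fg(3) A by (auto simp: c_def dest: fun_cong[of _ _ A])
    have "norm ((f x - p f x) - (f ?y - p f ?y)) \<le> \<delta>" "norm ((g x - p f x) - (g ?y - p f ?y)) \<le> \<delta>"
      using osc_le[of f A x ?y] osc_le[of g A x ?y] fg A a pk by auto
    moreover have "norm (f ?y - k A f) \<le> \<epsilon>" "norm (g ?y - k A f) \<le> \<epsilon>"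
      using k[of A f] k[of A g] fg A pk by (auto simp: dist_norm)
    moreover have "norm (f x - g x)
        \<le> (norm ((f x - p f x) - (f ?y - p f ?y)) + norm (f ?y - k A f))
          + (norm ((g x - p f x) - (g ?y - p f ?y)) + norm (g ?y - k A f))"
    proof -
      \<comment> \<open>The values of \<open>p f\<close> and the point \<open>k A f\<close> occur in
        both groups and cancel.\<close>
      have "f x - g x = (((f x - p f x) - (f ?y - p f ?y)) + (f ?y - k A f))
          - (((g x - p f x) - (g ?y - p f ?y)) + (g ?y - k A f))"
        by simp
      then show ?thesis
        by (simp only:) (intro order_trans[OF norm_triangle_ineq4] add_mono norm_triangle_ineq)
    qed
    ultimately show ?thesis
      by simp
  qed
  show thesis
    using that F close by (metis subsetD)
qed

theorem theorem3p3:
  fixes \<Omega> :: "'a set" and X M :: "('a \<Rightarrow> 'y::banach) set"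
  assumes "\<Omega> \<noteq> {}"
    and "banach_subspace \<Omega> X"
    and "M \<subseteq> X" and "M \<noteq> {}"
    and "Metric_space.mbounded (mspace (bfuns \<Omega>)) (mdist (bfuns \<Omega>)) M"
  shows "max (mu_gamma \<Omega> M) (1 / 2 * omega \<Omega> X M) \<le> hausdorff_mnc (submetric (bfuns \<Omega>) X) M
       \<and> hausdorff_mnc (submetric (bfuns \<Omega>) X) M \<le> 2 * (mu_gamma \<Omega> M + omega \<Omega> X M)"
proof -
  let ?B = "bfuns \<Omega>" and ?\<gamma> = "\<lambda>x. hausdorff_mnc euclidean_metric ((\<lambda>f. f x) ` M)"
  have XB: "X \<subseteq> mspace ?B"
    using assms(2) by (simp add: banach_subspace_def)
  then have mspace_X: "mspace (submetric ?B X) = X"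
    by auto
  have mdist_le_iff: "mdist ?B f g \<le> r \<longleftrightarrow> (\<forall>x\<in>\<Omega>. norm (f x - g x) \<le> r)"
    if "f \<in> X" "g \<in> X" for f g r
    using mdist_bfuns_le_iff[OF assms(1)] that XB by blast
  have part: "partition_on \<Omega> {\<Omega>}"
    using assms(1) by (simp add: partition_on_space)
  obtain f0 where f0: "f0 \<in> M"
    using assms(4) by blast
  obtain b where "\<forall>f\<in>M. \<forall>g\<in>M. mdist ?B f g \<le> b"
    using assms(5) by (auto simp: Metric_space.mbounded_alt[OF Metric_space_mspace_mdist])
  \<comment> \<open>The bound is enlarged to be positive, so that \<open>{f0}\<close> is a net of
    \<open>M\<close> with admissible mesh \<open>b\<close>.\<close>
  then obtain b where b: "b > 0" "\<And>f g. \<lbrakk>f \<in> M; g \<in> M\<rbrakk> \<Longrightarrow> mdist ?B f g \<le> b"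
    by (metis le_max_iff_disj less_max_iff_disj zero_less_one)
  have b_pt: "norm (f x - f0 x) \<le> b" if "f \<in> M" "x \<in> \<Omega>" for f x
    using b(2)[OF that(1) f0] that assms(3) f0 mdist_le_iff by blast

  have mnc_pt: "?\<gamma> x \<le> \<epsilon>"
    if "\<epsilon> > 0" "finite F" "F \<subseteq> X" and net: "\<And>f. f \<in> M \<Longrightarrow> \<exists>g\<in>F. mdist ?B f g \<le> \<epsilon>" and "x \<in> \<Omega>" for \<epsilon> F x
  proof (rule hausdorff_mnc_le[of _ "(\<lambda>f. f x) ` F"])
    fix y assume "y \<in> (\<lambda>f. f x) ` M"
    then obtain f where f: "f \<in> M" "y = f x" by blast
    then obtain g where "g \<in> F" "mdist ?B f g \<le> \<epsilon>"
      using net by blast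
    then show "\<exists>z\<in>(\<lambda>f. f x) ` F. mdist euclidean_metric y z \<le> \<epsilon>"
      using f that(3,5) assms(3) mdist_le_iff[of f g \<epsilon>] by (force simp: dist_norm)
  qed (use that in auto)
  have omega_net: "omega \<Omega> X M \<le> 2 * \<epsilon>"
    if "\<epsilon> > 0" "finite F" "F \<subseteq> X" and net: "\<And>f. f \<in> M \<Longrightarrow> \<exists>g\<in>F. mdist ?B f g \<le> \<epsilon>" for \<epsilon> F
  proof (rule omega_le[of _ "{\<Omega>}" _ F])
    fix f assume f: "f \<in> M"
    then obtain g where g: "g \<in> F" "mdist ?B f g \<le> \<epsilon>"
      using net by blast
    then have "\<And>x. x \<in> \<Omega> \<Longrightarrow> norm (f x - g x) \<le> \<epsilon>"
      using mdist_le_iff[of f g \<epsilon>] f that(3) assms(3) by blast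
    then have "diameter ((\<lambda>x. f x - g x) ` \<Omega>) \<le> 2 * \<epsilon>"
      by (rule diameter_diff_le[OF assms(1)])
    then show "\<exists>\<phi>\<in>F. \<forall>A\<in>{\<Omega>}. diameter ((\<lambda>x. f x - \<phi> x) ` A) \<le> 2 * \<epsilon>"
      using g(1) by auto
  qed (use that part in auto)
  have lower: "max (mu_gamma \<Omega> M) (1 / 2 * omega \<Omega> X M) \<le> hausdorff_mnc (submetric ?B X) M"
  proof (rule hausdorff_mnc_greatest[of b "{f0}"])
    fix \<epsilon> :: real and F :: "('a \<Rightarrow> 'y) set"
    assume "\<epsilon> > 0" "finite F" "F \<subseteq> mspace (submetric ?B X)"
      and "\<And>f. f \<in> M \<Longrightarrow> \<exists>g\<in>F. mdist (submetric ?B X) f g \<le> \<epsilon>"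
    then have net: "\<epsilon> > 0" "finite F" "F \<subseteq> X" "\<And>f. f \<in> M \<Longrightarrow> \<exists>g\<in>F. mdist ?B f g \<le> \<epsilon>"
      using mspace_X by auto
    have "mu_gamma \<Omega> M \<le> \<epsilon>"
      unfolding mu_gamma_def using assms(1) mnc_pt[OF net] by (intro cSUP_least) auto
    then show "max (mu_gamma \<Omega> M) (1 / 2 * omega \<Omega> X M) \<le> \<epsilon>"
      using omega_net[OF net] by simp
  qed (use b f0 assms(3) mspace_X in auto)

  \<comment> \<open>Evaluating the net \<open>{f0}\<close> bounds all pointwise measures by
    \<open>b\<close>, so the supremum in \<open>mu_gamma\<close> is a genuine one.\<close>
  have bdd: "bdd_above (?\<gamma> ` \<Omega>)"
    using mnc_pt[of b "{f0}"] b f0 assms(3) by (intro bdd_aboveI2[of _ _ b]) auto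
  have net_pt: "\<exists>N. finite N \<and> (\<forall>f\<in>M. \<exists>y\<in>N. dist (f x) y \<le> \<epsilon>)"
    if "mu_gamma \<Omega> M < \<epsilon>" and x: "x \<in> \<Omega>" for x \<epsilon>
  proof -
    have "?\<gamma> x < \<epsilon>"
      using cSUP_upper[OF that(2) bdd] that(1) by (simp add: mu_gamma_def)
    then obtain N where "finite N" "\<And>y. y \<in> (\<lambda>f. f x) ` M \<Longrightarrow> \<exists>z\<in>N. mdist euclidean_metric y z \<le> \<epsilon>"
      by (rule hausdorff_mnc_lessE[of _ _ _ b "{f0 x}"])
        (use b(1) b_pt[OF _ x] in \<open>auto simp: dist_norm\<close>)
    then show ?thesis by auto
  qed
  have upper_net: "hausdorff_mnc (submetric ?B X) M \<le> 2 * (\<epsilon> + \<delta>)"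
    if mu: "mu_gamma \<Omega> M < \<epsilon>" and "\<delta> > 0" and P: "finite P" "partition_on \<Omega> P" "finite \<Phi>" and "\<Phi> \<subseteq> X"
      and osc: "\<And>f. f \<in> M \<Longrightarrow> \<exists>\<phi>\<in>\<Phi>. \<forall>A\<in>P. diameter ((\<lambda>x. f x - \<phi> x) ` A) \<le> \<delta>"
    for \<epsilon> \<delta> P \<Phi>
  proof -
    obtain x0 where "x0 \<in> \<Omega>"
      using assms(1) by blast
    \<comment> \<open>Some distance from \<open>f0 x0\<close> to a net point is at most
      \<open>\<epsilon>\<close>; with \<open>\<delta> > 0\<close> this makes the mesh
      \<open>2 * (\<epsilon> + \<delta>)\<close> positive.\<close>
    then have "\<epsilon> \<ge> 0"
      using net_pt[OF mu] f0 by (meson dual_order.trans zero_le_dist)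
    have bnd: "bounded (f ` \<Omega>)" if "f \<in> M \<union> \<Phi>" for f
      using that \<open>\<Phi> \<subseteq> X\<close> assms(3) XB by (auto simp: mspace_bfuns)
    obtain F where F: "finite F" "F \<subseteq> M"
      "\<And>f. f \<in> M \<Longrightarrow> \<exists>g\<in>F. \<forall>x\<in>\<Omega>. norm (f x - g x) \<le> 2 * (\<epsilon> + \<delta>)"
      using finite_net_of_oscillation[OF P bnd osc net_pt[OF mu]] by metis
    show ?thesis
    proof (rule hausdorff_mnc_le[of _ F])
      fix f assume f: "f \<in> M"
      then obtain g where "g \<in> F" "\<forall>x\<in>\<Omega>. norm (f x - g x) \<le> 2 * (\<epsilon> + \<delta>)"
        using F(3) by blast
      then show "\<exists>g\<in>F. mdist (submetric ?B X) f g \<le> 2 * (\<epsilon> + \<delta>)"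
        using f F(2) assms(3) mdist_le_iff[of f g "2 * (\<epsilon> + \<delta>)"] unfolding mdist_submetric by blast
    qed (use F assms(3) mspace_X \<open>\<epsilon> \<ge> 0\<close> \<open>\<delta> > 0\<close> in auto)
  qed
  \<comment> \<open>The bound of \<open>upper_net\<close> is solved for \<open>\<delta>\<close>, so
    that the infimum over \<open>\<delta>\<close> can be taken with \<open>\<epsilon>\<close>
    fixed.\<close>
  have "hausdorff_mnc (submetric ?B X) M / 2 - \<epsilon> \<le> omega \<Omega> X M" if "mu_gamma \<Omega> M < \<epsilon>" for \<epsilon>
    unfolding omega_def
  proof (rule cInf_greatest, goal_cases)
    case 1
    \<comment> \<open>The trivial partition and \<open>f0\<close> alone show that
      \<open>2 * b\<close> is admissible for \<open>omega\<close>.\<close>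
    have "diameter ((\<lambda>x. f x - f0 x) ` \<Omega>) \<le> 2 * b" if "f \<in> M" for f
      using b_pt[OF that] by (rule diameter_diff_le[OF assms(1)])
    then show ?case
      using b(1) f0 assms(3) part
      by (auto intro!: exI[of _ "2 * b"] exI[of _ "{\<Omega>}"] exI[of _ "{f0}"])
  next
    case (2 \<delta>)
    then show ?case
      using upper_net[OF that, of \<delta>] by fastforce
  qed
  then have "hausdorff_mnc (submetric ?B X) M / 2 - omega \<Omega> X M \<le> \<epsilon>" if "mu_gamma \<Omega> M < \<epsilon>" for \<epsilon>
    using that by (simp add: algebra_simps)
  \<comment> \<open>Finally \<open>\<epsilon>\<close> decreases to
    \<open>mu_gamma \<Omega> M\<close>, which removes the strict inequality.\<close>
  then have "hausdorff_mnc (submetric ?B X) M / 2 - omega \<Omega> X M \<le> mu_gamma \<Omega> M"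
    by (rule dense_ge)
  then show ?thesis
    using lower by simp
qed

end
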